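(* Let $b(n)$ be the total number of parts (counted with multiplicity) in all partitions in $\mathcal{B}_4(n)$ minus the total number of parts (counted with multiplicity) in all partitions in $\mathcal{PED}(n)$. Then for all $n\geq 0$, $$b(n)=|\mathcal{PED}_1(n)|=|\mathcal{B}_{4,1}(n)|.$$
   Context: A partition of $n$ is a non-increasing finite sequence of positive integers (parts) with sum $n$; the empty partition is the only partition of $0$. $\mathcal{B}_4(n)$ is the set of $4$-regular partitions of $n$, i.e. partitions of $n$ with no part congruent to $0 \bmod 4$. $\mathcal{PED}(n)$ is the set of partitions of $n$ in which no even part is repeated (odd parts are unrestricted). $\mathcal{PED}_1(n)$ is the set of partitions of $n$ in which exactly one even part is repeated (i.e. exactly one even integer occurs with multiplicity at least $2$), all other even parts are distinct (occur at most once), and odd parts are unrestricted. $\mathcal{B}_{4,1}(n)$ is the set of partitions of $n$ with exactly one part (possibly repeated) congruent to $0 \bmod 4$, i.e. exactly one multiple of $4$ occurs as a part value, with any multiplicity at least $1$, and all other parts are not congruent to $0\bmod 4$. *)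

theory Defs
  imports Main
begin

definition partitions :: "nat \<Rightarrow> nat list set" where
  "partitions n = {xs. sorted_wrt (\<ge>) xs \<and> (\<forall>m\<in>set xs. 0 < m) \<and> sum_list xs = n}"

definition B4 :: "nat \<Rightarrow> nat list set" where
  "B4 n = {xs \<in> partitions n. \<forall>m\<in>set xs. m mod 4 \<noteq> 0}"

definition PED :: "nat \<Rightarrow> nat list set" where
  "PED n = {xs \<in> partitions n. \<forall>m\<in>set xs. even m \<longrightarrow> count_list xs m = 1}"

text \<open>Uniqueness of the repeated even part says that every other even part occurs at most once.\<close>

definition PED1 :: "nat \<Rightarrow> nat list set" where
  "PED1 n = {xs \<in> partitions n. \<exists>!m. m \<in> set xs \<and> even m \<and> 2 \<le> count_list xs m}"

text \<open>The unique multiple of 4 is unique as a value; its multiplicity is unrestricted.\<close>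

definition B41 :: "nat \<Rightarrow> nat list set" where
  "B41 n = {xs \<in> partitions n. \<exists>!m. m \<in> set xs \<and> m mod 4 = 0}"

definition b_parts :: "nat \<Rightarrow> int" where
  "b_parts n = int (\<Sum>xs\<in>B4 n. length xs) - int (\<Sum>xs\<in>PED n. length xs)"

text \<open>All sets above are finite, so the sums and cardinalities have their intended meaning.\<close>

lemma finite_partitions: "finite (partitions n)"
proof (rule finite_subset)
  have "length xs \<le> sum_list xs" if "\<forall>m\<in>set xs. 0 < m" for xs :: "nat list"
    using that by (induction xs) auto
  then show "partitions n \<subseteq> {xs. set xs \<subseteq> {..n} \<and> length xs \<le> n}"
    by (auto simp: partitions_def member_le_sum_list)
  show "finite {xs. set xs \<subseteq> {..n} \<and> length xs \<le> n}"
    by (rule finite_lists_length_le) simp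
qed

end

theory Submission
  imports Defs "HOL-Library.Multiset"
begin

text \<open>
  Write \<open>R n\<close> for the number of 4-regular partitions of \<open>n\<close> and \<open>D n\<close> for the number of
  partitions of \<open>n\<close> with distinct even parts. For a function \<open>f\<close> let \<open>stride_sum f m n\<close> be
  \<open>f (n - m) + f (n - 2 * m) + \<dots>\<close>, the sum continuing as long as the argument stays
  nonnegative; in terms of generating functions, \<open>f\<close> is multiplied by \<open>q^m / (1 - q^m)\<close>.

  If the multiplicity of \<open>m\<close> is unrestricted, then deleting \<open>j\<close> copies of \<open>m\<close> shows that \<open>m\<close>
  occurs altogether \<open>stride_sum f m n\<close> times in the partitions of \<open>n\<close>, where \<open>f\<close> counts the
  family (\<open>occurrences_unrestricted_part\<close>). If \<open>m\<close> may occur at most once, the inclusion-exclusion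
  identity \<open>x / (1 + x) = x / (1 - x) - 2 x^2 / (1 - x^2)\<close> with \<open>x = q^m\<close> gives
  \<open>stride_sum f m n - 2 * stride_sum f (2 * m) n\<close> instead (\<open>occurrences_unrepeated_part\<close>).
  Now give each part \<open>m\<close> a weight \<open>w m\<close>. The total weight is
  \<^item> \<open>\<Sum>m. w m * stride_sum R m n - (\<Sum>m | 4 dvd m. w m * stride_sum R m n)\<close> for the first family;
  \<^item> \<open>\<Sum>m. w m * stride_sum D m n - (\<Sum>m | 4 dvd m. 2 * w (m div 2) * stride_sum D m n)\<close> for the
    second one, because doubling the even numbers gives the multiples of 4.

  The proof reads this pair of formulas twice. For \<open>w m = m\<close> the two right-hand sides have the same
  coefficients, and the left-hand sides are \<open>n * R n\<close> and \<open>n * D n\<close>; since the right-hand sides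
  involve only arguments below \<open>n\<close>, induction yields \<open>R = D\<close>. For \<open>w m = 1\<close> the left-hand sides
  are the total numbers of parts, and the formulas now differ by
  \<open>S = (\<Sum>m | 4 dvd m. stride_sum R m n)\<close>.

  Finally, \<open>S\<close> counts both of the remaining families. Deleting all copies of the only multiple
  \<open>m\<close> of 4 leaves a 4-regular partition, and deleting the copies of the only repeated even part
  \<open>m\<close> in pairs, until at most one is left, leaves a partition with distinct even parts of
  \<open>n - j * (2 * m)\<close> for some \<open>j > 0\<close>; here \<open>2 * m\<close> is again an arbitrary multiple of 4.
\<close>

section \<open>Partitions as multisets\<close>

definition mpart :: "(nat multiset \<Rightarrow> bool) \<Rightarrow> nat \<Rightarrow> nat multiset set" where
  "mpart P n = {M. P M \<and> 0 \<notin># M \<and> \<Sum>\<^sub># M = n}"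

lemma bij_betw_mset_partitions:
  "bij_betw mset {xs \<in> partitions n. P (mset xs)} (mpart P n)"
proof (rule bij_betw_byWitness[where f' = "\<lambda>M. rev (sorted_list_of_multiset M)"])
  show "\<forall>xs\<in>{xs \<in> partitions n. P (mset xs)}. rev (sorted_list_of_multiset (mset xs)) = xs"
  proof
    fix xs assume "xs \<in> {xs \<in> partitions n. P (mset xs)}"
    then have "sorted (rev xs)"
      by (simp add: partitions_def sorted_wrt_rev)
    then have "sort xs = rev xs"
      by (metis mset_rev properties_for_sort)
    then show "rev (sorted_list_of_multiset (mset xs)) = xs"
      by simp
  qed
  show "\<forall>M\<in>mpart P n. mset (rev (sorted_list_of_multiset M)) = M"
    by simp
  show "mset ` {xs \<in> partitions n. P (mset xs)} \<subseteq> mpart P n"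
    by (auto simp: mpart_def partitions_def sum_mset_sum_list)
  show "(\<lambda>M. rev (sorted_list_of_multiset M)) ` mpart P n
      \<subseteq> {xs \<in> partitions n. P (mset xs)}"
  proof
    fix xs assume "xs \<in> (\<lambda>M. rev (sorted_list_of_multiset M)) ` mpart P n"
    then obtain M where M: "M \<in> mpart P n" and xs: "xs = rev (sorted_list_of_multiset M)"
      by blast
    have "sum_list xs = \<Sum>\<^sub># (mset xs)"
      by (simp only: sum_mset_sum_list)
    moreover have "mset xs = M"
      by (simp add: xs)
    moreover have "sorted_wrt (\<ge>) xs"
      by (simp add: xs sorted_wrt_rev)
    moreover have "\<forall>x\<in>set xs. 0 < x"
      using M by (auto simp: mpart_def xs intro!: gr0I)
    ultimately show "xs \<in> {xs \<in> partitions n. P (mset xs)}"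
      using M by (simp add: mpart_def partitions_def)
  qed
qed

lemma finite_mpart [simp]: "finite (mpart P n)"
  using bij_betw_finite[OF bij_betw_mset_partitions[of n P]] finite_partitions[of n] by simp

lemma mpart_parts:
  assumes "M \<in> mpart P n"
  shows "set_mset M \<subseteq> {1..n}"
proof
  fix x assume "x \<in># M"
  moreover from this obtain N where "M = add_mset x N"
    by (rule mset_add)
  ultimately show "x \<in> {1..n}"
    using assms by (cases "x = 0") (auto simp: mpart_def)
qed

lemma card_mpart_0: "P {#} \<Longrightarrow> card (mpart P 0) = 1"
proof -
  assume "P {#}"
  then have "mpart P 0 = {{#}}"
    using mpart_parts[of _ P 0] by (fastforce simp: mpart_def)
  then show ?thesis by simp
qed

text \<open>
  The bijection behind all the recursions below: a partition with at least \<open>k\<close> copies of \<open>m\<close>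
  is an arbitrary multiset with \<open>k\<close> copies of \<open>m\<close> added, and \<open>P'\<close> is the property \<open>P\<close> pulled
  back along this addition.
\<close>

lemma sum_mpart_remove_copies:
  fixes g :: "nat multiset \<Rightarrow> nat"
  assumes "m > 0" and P': "\<And>M. P' M \<longleftrightarrow> P (M + replicate_mset k m)"
  shows "(\<Sum>M | M \<in> mpart P n \<and> k \<le> count M m. g M)
    = (if n < k * m then 0 else \<Sum>M\<in>mpart P' (n - k * m). g (M + replicate_mset k m))"
proof (cases "n < k * m")
  case True
  have "\<not> k \<le> count M m" if M: "M \<in> mpart P n" for M
  proof
    assume "k \<le> count M m"
    then have "replicate_mset k m \<subseteq># M"
      by (simp add: count_le_replicate_mset_subset_eq)
    then obtain N where "M = N + replicate_mset k m"
      by (metis subset_mset.diff_add)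
    with M True show False by (simp add: mpart_def)
  qed
  then have "{M. M \<in> mpart P n \<and> k \<le> count M m} = {}" by blast
  with True show ?thesis by (simp del: Collect_empty_eq)
next
  case False
  have img: "{M. M \<in> mpart P n \<and> k \<le> count M m}
    = (\<lambda>M. M + replicate_mset k m) ` mpart P' (n - k * m)"
  proof (intro equalityI subsetI)
    fix M assume "M \<in> {M. M \<in> mpart P n \<and> k \<le> count M m}"
    then have M: "M \<in> mpart P n" and "replicate_mset k m \<subseteq># M"
      by (simp_all add: count_le_replicate_mset_subset_eq)
    then obtain N where "M = N + replicate_mset k m"
      by (metis subset_mset.diff_add)
    with M show "M \<in> (\<lambda>M. M + replicate_mset k m) ` mpart P' (n - k * m)"
      by (intro image_eqI[of _ _ N]) (auto simp: mpart_def P')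
  next
    fix M assume "M \<in> (\<lambda>M. M + replicate_mset k m) ` mpart P' (n - k * m)"
    with False \<open>m > 0\<close> show "M \<in> {M. M \<in> mpart P n \<and> k \<le> count M m}"
      by (auto simp: mpart_def P' split: if_splits)
  qed
  from False show ?thesis
    unfolding img by (subst sum.reindex) (auto simp: inj_on_def)
qed

section \<open>Sums along arithmetic progressions\<close>

fun stride_sum :: "(nat \<Rightarrow> nat) \<Rightarrow> nat \<Rightarrow> nat \<Rightarrow> nat" where
  "stride_sum f m n = (if m = 0 \<or> n < m then 0 else f (n - m) + stride_sum f m (n - m))"

declare stride_sum.simps [simp del]

lemma stride_sum_less [simp]: "n < m \<Longrightarrow> stride_sum f m n = 0"
  by (simp add: stride_sum.simps)

lemma stride_sum_step:
  "0 < m \<Longrightarrow> m \<le> n \<Longrightarrow> stride_sum f m n = f (n - m) + stride_sum f m (n - m)"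
  by (subst stride_sum.simps) simp

lemma stride_sum_cong:
  "(\<And>k. k < n \<Longrightarrow> f k = g k) \<Longrightarrow> stride_sum f m n = stride_sum g m n"
proof (induction n rule: less_induct)
  case (less n)
  show ?case
  proof (cases "m = 0 \<or> n < m")
    case True
    then show ?thesis by (simp add: stride_sum.simps)
  next
    case False
    then show ?thesis
      using less by (simp add: stride_sum_step)
  qed
qed

text \<open>
  Deleting a single block of parts yields a recursion of this form, and the recursion determines
  the count.
\<close>

lemma stride_sum_unique:
  assumes "0 < m"
    and less: "\<And>n. n < m \<Longrightarrow> h n = 0"
    and step: "\<And>n. m \<le> n \<Longrightarrow> h n = f (n - m) + h (n - m)"
  shows "h n = stride_sum f m n"
proof (induction n rule: less_induct)
  case (less n)
  with assms show ?case
    by (cases "n < m") (simp_all add: stride_sum_step)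
qed

text \<open>
  The recursion unfolds to the alternating sum \<open>f (n - m) - f (n - 2 * m) + f (n - 3 * m) - \<dots>\<close>,
  and twice the terms at the even multiples of \<open>m\<close> turns all signs positive.
\<close>

lemma stride_sum_alternating:
  assumes "0 < m"
    and less: "\<And>n. n < m \<Longrightarrow> h n = 0"
    and step: "\<And>n. m \<le> n \<Longrightarrow> h n + h (n - m) = f (n - m)"
  shows "h n + 2 * stride_sum f (2 * m) n = stride_sum f m n"
proof (induction n rule: less_induct)
  case (less n)
  \<comment> \<open>One step of the sum on the left has length \<open>2 * m\<close>, so the recursion is used twice.\<close>
  consider "n < m" | "m \<le> n" "n < 2 * m" | "2 * m \<le> n" by linarith
  then show ?case
  proof cases
    case 1
    then show ?thesis using assms by simp
  next
    case 2
    then have "h (n - m) = 0"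
      by (intro assms(2)) simp
    with 2 show ?thesis
      using step[of n] \<open>0 < m\<close> by (simp add: stride_sum_step)
  next
    case 3
    have d: "n - m - m = n - 2 * m" by simp
    have "h n + h (n - m) = f (n - m)" "h (n - m) + h (n - 2 * m) = f (n - 2 * m)"
      using step[of n] step[of "n - m"] 3 d by simp_all
    moreover have "stride_sum f m n = f (n - m) + (f (n - 2 * m) + stride_sum f m (n - 2 * m))"
      using 3 \<open>0 < m\<close> stride_sum_step[of m n f] stride_sum_step[of m "n - m" f] d by simp
    moreover have "stride_sum f (2 * m) n = f (n - 2 * m) + stride_sum f (2 * m) (n - 2 * m)"
      using 3 \<open>0 < m\<close> by (intro stride_sum_step) simp_all
    moreover have "h (n - 2 * m) + 2 * stride_sum f (2 * m) (n - 2 * m)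
        = stride_sum f m (n - 2 * m)"
      using less 3 \<open>0 < m\<close> by simp
    ultimately show ?thesis by linarith
  qed
qed

section \<open>Counting occurrences of a part\<close>

definition occurrences :: "(nat multiset \<Rightarrow> bool) \<Rightarrow> nat \<Rightarrow> nat \<Rightarrow> nat" where
  "occurrences P m n = (\<Sum>M\<in>mpart P n. count M m)"

lemma sum_mpart_parts:
  fixes w :: "nat \<Rightarrow> nat"
  shows "(\<Sum>M\<in>mpart P n. \<Sum>x\<in>#M. w x) = (\<Sum>m=1..n. w m * occurrences P m n)"
proof -
  have *: "(\<Sum>x\<in>#M. w x) = (\<Sum>m\<in>A. w m * count M m)"
    if "finite A" "set_mset M \<subseteq> A" for M A
    using that(2)
  proof (induction M)
    case (add x M)
    have "(\<Sum>m\<in>A. w m * count (add_mset x M) m)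
        = (\<Sum>m\<in>A. w m * count M m + (if m = x then w m else 0))"
      by (intro sum.cong) auto
    with add that(1) show ?case
      by (simp add: sum.distrib)
  qed simp
  have "(\<Sum>M\<in>mpart P n. \<Sum>x\<in>#M. w x) = (\<Sum>M\<in>mpart P n. \<Sum>m=1..n. w m * count M m)"
    by (intro sum.cong refl * mpart_parts) simp
  also have "\<dots> = (\<Sum>m=1..n. \<Sum>M\<in>mpart P n. w m * count M m)"
    by (rule sum.swap)
  finally show ?thesis
    by (simp add: occurrences_def sum_distrib_left)
qed

lemma sum_size_mpart: "(\<Sum>M\<in>mpart P n. size M) = (\<Sum>m=1..n. occurrences P m n)"
  using sum_mpart_parts[of "\<lambda>_. 1" P n] by simp

text \<open>
  This is the logarithmic derivative of the generating function: it expresses the size of a family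
  through the numbers of occurrences, which in turn depend only on the sizes for smaller \<open>n\<close>.
\<close>

lemma n_times_card_mpart: "n * card (mpart P n) = (\<Sum>m=1..n. m * occurrences P m n)"
proof -
  have "(\<Sum>M\<in>mpart P n. \<Sum>x\<in>#M. x) = (\<Sum>M\<in>mpart P n. n)"
    by (intro sum.cong) (auto simp: mpart_def)
  then show ?thesis
    using sum_mpart_parts[of "\<lambda>x. x" P n] by (simp add: mult.commute)
qed

lemma occurrences_eq_sum_present:
  "occurrences P m n = (\<Sum>M | M \<in> mpart P n \<and> 1 \<le> count M m. count M m)"
  unfolding occurrences_def by (intro sum.mono_neutral_right) (auto simp: not_in_iff)

lemma occurrences_unrestricted_part:
  assumes "0 < m" and "\<And>M. P (add_mset m M) \<longleftrightarrow> P M"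
  shows "occurrences P m n = stride_sum (\<lambda>k. card (mpart P k)) m n"
proof (rule stride_sum_unique[OF \<open>0 < m\<close>])
  have *: "occurrences P m n
      = (if n < m then 0 else \<Sum>M\<in>mpart P (n - m). Suc (count M m))" for n
    using sum_mpart_remove_copies[of m P P 1 "\<lambda>M. count M m" n] assms
    by (simp add: occurrences_eq_sum_present)
  show "occurrences P m n = 0" if "n < m" for n
    using that by (simp add: *)
  show "occurrences P m n = card (mpart P (n - m)) + occurrences P m (n - m)" if "m \<le> n" for n
    using that by (subst *) (simp add: occurrences_def sum_Suc)
qed

text \<open>
  Deleting the copy of \<open>m\<close> leads to the partitions of \<open>n - m\<close> in the family that avoid \<open>m\<close>, and
  those that contain \<open>m\<close> are counted by \<open>occurrences P m (n - m)\<close>. This is the alternating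
  recursion.
\<close>

lemma occurrences_unrepeated_part:
  assumes "0 < m" and "\<And>M. P (add_mset m M) \<longleftrightarrow> P M \<and> m \<notin># M"
    and "\<And>M. P M \<Longrightarrow> count M m \<le> 1"
  shows "occurrences P m n + 2 * stride_sum (\<lambda>k. card (mpart P k)) (2 * m) n
    = stride_sum (\<lambda>k. card (mpart P k)) m n"
proof (rule stride_sum_alternating[OF \<open>0 < m\<close>])
  have *: "occurrences P m n
      = (if n < m then 0 else \<Sum>M\<in>mpart (\<lambda>M. P M \<and> m \<notin># M) (n - m). Suc (count M m))" for n
    using sum_mpart_remove_copies[of m "\<lambda>M. P M \<and> m \<notin># M" P 1 "\<lambda>M. count M m" n] assms
    by (simp add: occurrences_eq_sum_present)
  show "occurrences P m n = 0" if "n < m" for n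
    using that by (simp add: *)
  show "occurrences P m n + occurrences P m (n - m) = card (mpart P (n - m))" if "m \<le> n" for n
  proof -
    \<comment> \<open>There is at most one copy of \<open>m\<close>, so \<open>1 - count M m\<close> indicates that \<open>m\<close> is absent.\<close>
    have "(\<Sum>M\<in>mpart (\<lambda>M. P M \<and> m \<notin># M) (n - m). Suc (count M m))
        = (\<Sum>M\<in>mpart P (n - m). 1 - count M m)"
      by (rule sum.mono_neutral_cong_left[OF finite_mpart]) (auto simp: mpart_def not_in_iff)
    moreover have "(\<Sum>M\<in>mpart P (n - m). 1 - count M m) + occurrences P m (n - m)
        = (\<Sum>M\<in>mpart P (n - m). 1)"
      unfolding occurrences_def sum.distrib[symmetric]
      using assms(3) by (intro sum.cong) (auto simp: mpart_def)
    ultimately show ?thesis using that by (simp add: *)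
  qed
qed

text \<open>
  Remove \<open>k\<close> copies of \<open>m\<close> at a time until fewer than \<open>k\<close> are left, that is, until \<open>Q\<close> holds.
  The case \<open>k = 1\<close> serves for a unique multiple of 4 and \<open>k = 2\<close> for a unique repeated even part.
\<close>

lemma card_mpart_exceeding:
  assumes "0 < m" "0 < k" and "\<And>M. P (M + replicate_mset k m) \<longleftrightarrow> P M"
    and "\<And>M. Q M \<longleftrightarrow> P M \<and> count M m < k"
  shows "card {M \<in> mpart P n. k \<le> count M m} = stride_sum (\<lambda>j. card (mpart Q j)) (k * m) n"
proof (rule stride_sum_unique)
  show "0 < k * m" using assms by simp
  have *: "card {M \<in> mpart P n. k \<le> count M m}
      = (if n < k * m then 0 else card (mpart P (n - k * m)))" for n
    using sum_mpart_remove_copies[of m P P k "\<lambda>_. 1" n] assms by simp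
  show "card {M \<in> mpart P n. k \<le> count M m} = 0" if "n < k * m" for n
    using that by (simp only: * if_True)
  show "card {M \<in> mpart P n. k \<le> count M m}
      = card (mpart Q (n - k * m)) + card {M \<in> mpart P (n - k * m). k \<le> count M m}"
    if "k * m \<le> n" for n
  proof -
    have "mpart P (n - k * m) = mpart Q (n - k * m) \<union> {M \<in> mpart P (n - k * m). k \<le> count M m}"
      by (auto simp: mpart_def assms(4))
    moreover have "mpart Q (n - k * m) \<inter> {M \<in> mpart P (n - k * m). k \<le> count M m} = {}"
      by (auto simp: mpart_def assms(4))
    ultimately have "card (mpart P (n - k * m))
        = card (mpart Q (n - k * m)) + card {M \<in> mpart P (n - k * m). k \<le> count M m}"
      by (metis (no_types, lifting) card_Un_disjoint finite_Un finite_mpart)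
    moreover have "card {M \<in> mpart P n. k \<le> count M m} = card (mpart P (n - k * m))"
      using that by (subst *) simp
    ultimately show ?thesis by simp
  qed
qed

section \<open>The four families\<close>

definition regular4 :: "nat multiset \<Rightarrow> bool" where
  "regular4 M \<longleftrightarrow> (\<forall>x\<in>#M. \<not> 4 dvd x)"

definition evens_distinct :: "nat multiset \<Rightarrow> bool" where
  "evens_distinct M \<longleftrightarrow> (\<forall>x. even x \<longrightarrow> count M x \<le> 1)"

abbreviation num_regular4 :: "nat \<Rightarrow> nat" where
  "num_regular4 n \<equiv> card (mpart regular4 n)"

abbreviation num_evens_distinct :: "nat \<Rightarrow> nat" where
  "num_evens_distinct n \<equiv> card (mpart evens_distinct n)"

lemma occurrences_regular4:
  assumes "0 < m"
  shows "occurrences regular4 m n = (if 4 dvd m then 0 else stride_sum num_regular4 m n)"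
proof (cases "4 dvd m")
  case True
  have "count M m = 0" if "M \<in> mpart regular4 n" for M
    using that True by (force simp: mpart_def regular4_def not_in_iff)
  with True show ?thesis by (simp add: occurrences_def)
next
  case False
  then show ?thesis
    using occurrences_unrestricted_part[OF assms, of regular4 n] by (simp add: regular4_def)
qed

lemma occurrences_evens_distinct:
  assumes "0 < m"
  shows "occurrences evens_distinct m n
      + (if even m then 2 * stride_sum num_evens_distinct (2 * m) n else 0)
    = stride_sum num_evens_distinct m n"
proof (cases "even m")
  case True
  have "evens_distinct (add_mset m M) \<longleftrightarrow> evens_distinct M \<and> m \<notin># M" for M
  proof -
    have "count (add_mset m M) x \<le> 1 \<longleftrightarrow> count M x \<le> 1 \<and> (x = m \<longrightarrow> m \<notin># M)" for x
      by (auto simp: not_in_iff)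
    with True show ?thesis
      unfolding evens_distinct_def by blast
  qed
  then show ?thesis
    using True occurrences_unrepeated_part[OF assms, of evens_distinct n]
    by (simp add: evens_distinct_def)
next
  case False
  have "evens_distinct (add_mset m M) \<longleftrightarrow> evens_distinct M" for M
    using False by (auto simp: evens_distinct_def)
  then show ?thesis
    using False occurrences_unrestricted_part[OF assms, of evens_distinct n] by simp
qed

text \<open>
  The multiples of 4 are the doubled even numbers. Doubling an even number up to \<open>n\<close> may
  exceed \<open>n\<close>, but then the stride sum is empty.
\<close>

lemma sum_stride_doubled_evens:
  "(\<Sum>m | m \<in> {1..n} \<and> even m. g (2 * m) * stride_sum f (2 * m) n)
    = (\<Sum>m | m \<in> {1..n} \<and> 4 dvd m. g m * stride_sum f m n)"
proof -
  have "(\<Sum>m | m \<in> {1..n} \<and> 4 dvd m. g m * stride_sum f m n)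
      = (\<Sum>m\<in>(*) 2 ` {m \<in> {1..n}. even m}. g m * stride_sum f m n)"
  proof (intro sum.mono_neutral_left ballI)
    show "{m \<in> {1..n}. 4 dvd m} \<subseteq> (*) 2 ` {m \<in> {1..n}. even m}"
    proof
      fix m assume m: "m \<in> {m \<in> {1..n}. 4 dvd m}"
      then obtain c where "m = 4 * c" by auto
      with m show "m \<in> (*) 2 ` {m \<in> {1..n}. even m}"
        by (intro image_eqI[of _ _ "2 * c"]) auto
    qed
    fix m assume "m \<in> (*) 2 ` {m \<in> {1..n}. even m} - {m \<in> {1..n}. 4 dvd m}"
    then have "n < m" by (auto elim!: evenE)
    then show "g m * stride_sum f m n = 0" by simp
  qed simp
  also have "\<dots> = (\<Sum>m | m \<in> {1..n} \<and> even m. g (2 * m) * stride_sum f (2 * m) n)"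
    by (subst sum.reindex) (auto simp: inj_on_def)
  finally show ?thesis by simp
qed

lemma sum_occurrences_regular4:
  "(\<Sum>m=1..n. w m * occurrences regular4 m n)
      + (\<Sum>m | m \<in> {1..n} \<and> 4 dvd m. w m * stride_sum num_regular4 m n)
    = (\<Sum>m=1..n. w m * stride_sum num_regular4 m n)"
proof -
  have "(\<Sum>m | m \<in> {1..n} \<and> 4 dvd m. w m * stride_sum num_regular4 m n)
      = (\<Sum>m=1..n. if 4 dvd m then w m * stride_sum num_regular4 m n else 0)"
    by (rule sum.inter_filter) simp
  then show ?thesis
    by (simp add: occurrences_regular4 flip: sum.distrib) (intro sum.cong, auto)
qed

text \<open>
  Every even \<open>m\<close> contributes a defect \<open>2 * w m\<close> times a stride sum of step \<open>2 * m\<close>. The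
  function \<open>v\<close> attaches this defect to the multiple \<open>2 * m\<close> of 4: it is \<open>v m = m\<close> for
  \<open>w m = m\<close>, but \<open>v m = 2\<close> for \<open>w m = 1\<close>.
\<close>

lemma sum_occurrences_evens_distinct:
  assumes "\<And>m. 2 * w m = v (2 * m)"
  shows "(\<Sum>m=1..n. w m * occurrences evens_distinct m n)
      + (\<Sum>m | m \<in> {1..n} \<and> 4 dvd m. v m * stride_sum num_evens_distinct m n)
    = (\<Sum>m=1..n. w m * stride_sum num_evens_distinct m n)"
proof -
  have "(\<Sum>m | m \<in> {1..n} \<and> 4 dvd m. v m * stride_sum num_evens_distinct m n)
      = (\<Sum>m | m \<in> {1..n} \<and> even m. v (2 * m) * stride_sum num_evens_distinct (2 * m) n)"
    by (simp only: sum_stride_doubled_evens)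
  also have "\<dots> = (\<Sum>m=1..n. w m *
      (if even m then 2 * stride_sum num_evens_distinct (2 * m) n else 0))"
    by (subst sum.inter_filter) (auto intro!: sum.cong simp flip: assms)
  finally show ?thesis
    by (simp flip: sum.distrib distrib_left add: occurrences_evens_distinct)
qed

text \<open>
  With the weight \<open>w m = m\<close> both families satisfy the same recursion for \<open>n\<close> times their size.
  It says nothing at \<open>n = 0\<close>, where both families consist of the empty partition.
\<close>

lemma num_regular4_eq_num_evens_distinct: "num_regular4 n = num_evens_distinct n"
proof (induction n rule: less_induct)
  case (less n)
  have eq: "stride_sum num_regular4 m n = stride_sum num_evens_distinct m n" for m
    using less by (rule stride_sum_cong)
  have "n * num_regular4 n = n * num_evens_distinct n"
    using sum_occurrences_regular4[of "\<lambda>m. m" n]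
      sum_occurrences_evens_distinct[of "\<lambda>m. m" "\<lambda>m. m" n]
    by (simp add: n_times_card_mpart eq)
  moreover have "num_regular4 0 = num_evens_distinct 0"
    by (simp add: card_mpart_0 regular4_def evens_distinct_def)
  ultimately show ?case by (cases "n = 0") auto
qed

lemma card_mpart_one_repeated_even:
  "card (mpart (\<lambda>M. \<exists>!m. m \<in># M \<and> even m \<and> 2 \<le> count M m) n)
    = (\<Sum>m | m \<in> {1..n} \<and> even m. stride_sum num_evens_distinct (2 * m) n)"
proof -
  \<comment> \<open>The multiplicity of \<open>m\<close> is left free, so that \<open>P m\<close> survives the removal of copies of \<open>m\<close>.\<close>
  define P where "P m M \<longleftrightarrow> (\<forall>x. even x \<and> x \<noteq> m \<longrightarrow> count M x \<le> 1)" for m :: nat and M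
  have "mpart (\<lambda>M. \<exists>!m. m \<in># M \<and> even m \<and> 2 \<le> count M m) n
      = (\<Union>m\<in>{m \<in> {1..n}. even m}. {M \<in> mpart (P m) n. 2 \<le> count M m})" (is "?L = ?R")
  proof (intro equalityI subsetI)
    fix M assume "M \<in> ?L"
    then obtain m where m: "m \<in># M" "even m" "2 \<le> count M m"
      and uniq: "\<And>x. x \<in># M \<Longrightarrow> even x \<Longrightarrow> 2 \<le> count M x \<Longrightarrow> x = m"
      unfolding mpart_def by blast
    have "count M x \<le> 1" if "even x" "x \<noteq> m" for x
    proof (rule ccontr)
      assume "\<not> count M x \<le> 1"
      then have "2 \<le> count M x" and "x \<in># M"
        by (simp_all flip: count_greater_zero_iff)
      with uniq[of x] that show False by blast
    qed
    then have "P m M" by (simp add: P_def)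
    moreover have "m \<in> {1..n}"
      using mpart_parts[OF \<open>M \<in> ?L\<close>] m(1) by blast
    ultimately show "M \<in> ?R"
      using m \<open>M \<in> ?L\<close> by (auto simp: mpart_def)
  next
    fix M assume "M \<in> ?R"
    then obtain m where m: "even m" "2 \<le> count M m" and M: "M \<in> mpart (P m) n"
      by blast
    have "x = m" if "even x" "2 \<le> count M x" for x
    proof (rule ccontr)
      assume "x \<noteq> m"
      with M that(1) have "count M x \<le> 1" by (simp add: mpart_def P_def)
      with that(2) show False by simp
    qed
    moreover have "m \<in># M"
      using m(2) by (simp flip: count_greater_zero_iff)
    ultimately have "\<exists>!m. m \<in># M \<and> even m \<and> 2 \<le> count M m"
      using m by blast
    with M show "M \<in> ?L" by (simp add: mpart_def)
  qed
  moreover have "card ?R = (\<Sum>m | m \<in> {1..n} \<and> even m. card {M \<in> mpart (P m) n. 2 \<le> count M m})"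
  proof (intro card_UN_disjoint ballI impI)
    fix i j :: nat
    assume i: "i \<in> {m \<in> {1..n}. even m}" and "i \<noteq> j"
    have "count M i \<le> 1" if "M \<in> mpart (P j) n" for M
      using that i \<open>i \<noteq> j\<close> by (simp add: mpart_def P_def)
    then show "{M \<in> mpart (P i) n. 2 \<le> count M i} \<inter> {M \<in> mpart (P j) n. 2 \<le> count M j} = {}"
      by fastforce
  qed simp_all
  moreover have "card {M \<in> mpart (P m) n. 2 \<le> count M m}
      = stride_sum num_evens_distinct (2 * m) n" if "m \<in> {m \<in> {1..n}. even m}" for m
  proof (rule card_mpart_exceeding)
    show "evens_distinct M \<longleftrightarrow> P m M \<and> count M m < 2" for M
      using that by (auto simp: evens_distinct_def P_def less_Suc_eq_le numeral_2_eq_2)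
  qed (use that in \<open>auto simp: P_def\<close>)
  ultimately show ?thesis by simp
qed

lemma card_mpart_one_multiple_of_4:
  "card (mpart (\<lambda>M. \<exists>!m. m \<in># M \<and> 4 dvd m) n)
    = (\<Sum>m | m \<in> {1..n} \<and> 4 dvd m. stride_sum num_regular4 m n)"
proof -
  define P where "P m M \<longleftrightarrow> (\<forall>x\<in>#M. 4 dvd x \<longrightarrow> x = m)" for m :: nat and M
  have "mpart (\<lambda>M. \<exists>!m. m \<in># M \<and> 4 dvd m) n
      = (\<Union>m\<in>{m \<in> {1..n}. 4 dvd m}. {M \<in> mpart (P m) n. 1 \<le> count M m})" (is "?L = ?R")
  proof (intro equalityI subsetI)
    fix M assume "M \<in> ?L"
    then obtain m where m: "m \<in># M" "4 dvd m" and "P m M"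
      unfolding mpart_def P_def by blast
    moreover have "m \<in> {1..n}"
      using mpart_parts[OF \<open>M \<in> ?L\<close>] m(1) by blast
    ultimately show "M \<in> ?R"
      using \<open>M \<in> ?L\<close> by (auto simp: mpart_def)
  next
    fix M assume "M \<in> ?R"
    then show "M \<in> ?L"
      by (auto simp: mpart_def P_def)
  qed
  moreover have "card ?R = (\<Sum>m | m \<in> {1..n} \<and> 4 dvd m. card {M \<in> mpart (P m) n. 1 \<le> count M m})"
  proof (intro card_UN_disjoint ballI impI)
    fix i j :: nat
    assume "i \<in> {m \<in> {1..n}. 4 dvd m}" and "i \<noteq> j"
    then have "i \<notin># M" if "M \<in> mpart (P j) n" for M
      using that by (auto simp: mpart_def P_def)
    then show "{M \<in> mpart (P i) n. 1 \<le> count M i} \<inter> {M \<in> mpart (P j) n. 1 \<le> count M j} = {}"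
      by auto
  qed simp_all
  moreover have "card {M \<in> mpart (P m) n. 1 \<le> count M m}
      = stride_sum num_regular4 (1 * m) n" if "m \<in> {m \<in> {1..n}. 4 dvd m}" for m
  proof (rule card_mpart_exceeding)
    show "regular4 M \<longleftrightarrow> P m M \<and> count M m < 1" for M
    proof -
      have "count M m < 1 \<longleftrightarrow> m \<notin># M" by (simp add: not_in_iff)
      with that show ?thesis
        unfolding regular4_def P_def by blast
    qed
  qed (use that in \<open>auto simp: P_def\<close>)
  ultimately show ?thesis by simp
qed

section \<open>The identity\<close>

theorem theorem9p3:
  fixes n :: nat
  shows "b_parts n = int (card (PED1 n)) \<and> int (card (PED1 n)) = int (card (B41 n))"
proof -
  have cnt: "count (mset xs) = count_list xs" for xs :: "nat list"
    by (rule ext) (simp add: count_mset)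
  have B4: "bij_betw mset (B4 n) (mpart regular4 n)"
    using bij_betw_mset_partitions[of n regular4]
    by (simp add: B4_def regular4_def mod_eq_0_iff_dvd)
  have PED: "bij_betw mset (PED n) (mpart evens_distinct n)"
  proof -
    have "(\<forall>m\<in>set xs. even m \<longrightarrow> count_list xs m = 1) \<longleftrightarrow> evens_distinct (mset xs)" for xs
    proof -
      have "(m \<in> set xs \<longrightarrow> count_list xs m = 1) \<longleftrightarrow> count_list xs m \<le> 1" for m
        using count_list_0_iff[of xs m] by (cases "m \<in> set xs") auto
      then show ?thesis
        unfolding evens_distinct_def cnt by blast
    qed
    then show ?thesis
      using bij_betw_mset_partitions[of n evens_distinct] by (simp add: PED_def)
  qed
  have PED1: "card (PED1 n) = card (mpart (\<lambda>M. \<exists>!m. m \<in># M \<and> even m \<and> 2 \<le> count M m) n)"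
    using bij_betw_same_card[OF bij_betw_mset_partitions[of n
        "\<lambda>M. \<exists>!m. m \<in># M \<and> even m \<and> 2 \<le> count M m"]]
    by (simp add: PED1_def cnt)
  have B41: "card (B41 n) = card (mpart (\<lambda>M. \<exists>!m. m \<in># M \<and> 4 dvd m) n)"
    using bij_betw_same_card[OF bij_betw_mset_partitions[of n "\<lambda>M. \<exists>!m. m \<in># M \<and> 4 dvd m"]]
    by (simp add: B41_def mod_eq_0_iff_dvd)
  have lengths: "(\<Sum>xs\<in>A. length xs) = (\<Sum>m=1..n. occurrences P m n)"
    if "bij_betw mset A (mpart P n)" for A P
    using sum.reindex_bij_betw[OF that, of size] by (simp add: sum_size_mpart)
  have same: "num_regular4 = num_evens_distinct"
    by (rule ext) (rule num_regular4_eq_num_evens_distinct)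
  let ?S = "\<Sum>m | m \<in> {1..n} \<and> 4 dvd m. stride_sum num_evens_distinct m n"
  have "card (PED1 n) = ?S"
    using sum_stride_doubled_evens[where g = "\<lambda>_. 1"]
    by (simp add: PED1 card_mpart_one_repeated_even)
  moreover have "card (B41 n) = ?S"
    by (simp add: B41 card_mpart_one_multiple_of_4 same)
  \<comment> \<open>With \<open>R = D\<close>, the part counts fall short of the same sum by \<open>?S\<close> and by \<open>2 * ?S\<close>.\<close>
  moreover have "(\<Sum>xs\<in>B4 n. length xs) = (\<Sum>xs\<in>PED n. length xs) + ?S"
    using sum_occurrences_regular4[of "\<lambda>_. 1" n]
      sum_occurrences_evens_distinct[of "\<lambda>_. 1" "\<lambda>_. 2" n]
    by (simp add: lengths[OF B4] lengths[OF PED] same flip: sum_distrib_left)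
  ultimately show ?thesis
    by (simp add: b_parts_def)
qed

end
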